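(* Let $d\ge2$, let $V:\mathbb{T}^d\to\mathbb{R}$ be analytic, let $\alpha,\omega,B$ be as fixed in the context, and define $W:\mathbb{T}^d\to\mathbb{R}$ by $W(B\theta)=\partial_\alpha V(\theta)$, where $\partial_\alpha=\alpha\cdot\nabla$. Then the equation $$\int_{\mathbb{T}^{d-1}}W(\psi,\eta)\,d\psi=0$$ for the unknown $\eta\in\mathbb{T}^1$ always has at least two solutions.
   Context: Notation: $\mathbb{T}^j=\mathbb{R}^j/\mathbb{Z}^j$. Points of $\mathbb{T}^d$ are written $(\psi,\eta)$ with $\psi\in\mathbb{T}^{d-1}$ and $\eta\in\mathbb{T}^1$ the last coordinate. Setting: $\alpha\in\mathbb{R}^d$ satisfies $k\cdot\alpha\ne0$ for all $k\in\mathbb{Z}^d\setminus\{0\}$. The number $\omega\in\mathbb{R}$ is resonant, i.e. there are $k\in\mathbb{Z}^d\setminus\{0\}$ and $m\in\mathbb{Z}$ with $k\cdot\omega\alpha=m$. The matrix $B\in SL(d,\mathbb{Z})$ is such that $B\omega\alpha=(\Omega,0)+L$ with $L\in\mathbb{Z}^d$ and $\Omega\in\mathbb{R}^{d-1}$ satisfying $\Omega\cdot k\notin\mathbb{Z}$ for all $k\in\mathbb{Z}^{d-1}\setminus\{0\}$. *)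

theory Defs
  imports "HOL-Analysis.Analysis"
begin

(* The dimension d >= 2 is the cardinality of the index type 'n option, so that d - 1 = CARD('n) >= 1.
   The index None is the last coordinate; the indices Some j are the first d - 1 coordinates. *)

definition torus_point :: "real ^ 'n \<Rightarrow> real \<Rightarrow> real ^ 'n::finite option" where
  "torus_point \<psi> \<eta> = (\<chi> i. case i of Some j \<Rightarrow> \<psi> $ j | None \<Rightarrow> \<eta>)"

definition of_int_vec :: "int ^ 'd \<Rightarrow> real ^ 'd::finite" where
  "of_int_vec k = (\<chi> i. real_of_int (k $ i))"

(* A function on the torus R^j / Z^j is represented by its Z^j-periodic lift to R^j. *)

definition periodic_lattice :: "(real ^ 'd::finite \<Rightarrow> 'b) \<Rightarrow> bool" where
  "periodic_lattice f \<longleftrightarrow> (\<forall>x k. f (x + of_int_vec k) = f x)"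

(* The unit cube is a fundamental domain for Z^j, so this is the integral over the torus
   of the function with periodic lift f, for normalised Haar measure. *)

definition torus_integral :: "(real ^ 'd::finite \<Rightarrow> real) \<Rightarrow> real" where
  "torus_integral f = integral (cbox 0 1) f"

(* Real analyticity in several variables: near every point x, the function is the sum of an
   (unconditionally) convergent power series in y - x, indexed by the multi-indices k. *)

definition real_analytic :: "(real ^ 'd::finite \<Rightarrow> real) \<Rightarrow> bool" where
  "real_analytic f \<longleftrightarrow>
     (\<forall>x. \<exists>r>0. \<exists>c :: ('d \<Rightarrow> nat) \<Rightarrow> real. \<forall>y\<in>ball x r.
        ((\<lambda>k. c k * (\<Prod>i\<in>UNIV. (y $ i - x $ i) ^ k i)) has_sum f y) UNIV)"

definition grad :: "(real ^ 'd::finite \<Rightarrow> real) \<Rightarrow> real ^ 'd \<Rightarrow> real ^ 'd" where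
  "grad f x = (\<chi> i. deriv (\<lambda>t. f (x + t *\<^sub>R axis i 1)) 0)"

definition dir_deriv :: "real ^ 'd::finite \<Rightarrow> (real ^ 'd \<Rightarrow> real) \<Rightarrow> real ^ 'd \<Rightarrow> real" where
  "dir_deriv a f x = a \<bullet> grad f x"

definition nonresonant :: "real ^ 'd::finite \<Rightarrow> bool" where
  "nonresonant a \<longleftrightarrow> (\<forall>k. k \<noteq> 0 \<longrightarrow> of_int_vec k \<bullet> a \<noteq> 0)"

definition resonant :: "real \<Rightarrow> real ^ 'd::finite \<Rightarrow> bool" where
  "resonant w a \<longleftrightarrow> (\<exists>k (m::int). k \<noteq> 0 \<and> of_int_vec k \<bullet> (w *\<^sub>R a) = of_int m)"

end

theory Submission
  imports Defs
begin

text \<open>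
  Let \<open>U = V \<circ> B\<^sup>-\<^sup>1\<close>, which is again periodic, and \<open>g(\<eta>) = \<integral> U(\<psi>, \<eta>) d\<psi>\<close>. Since \<open>W\<close> is the derivative of
  \<open>U\<close> in direction \<open>\<beta> = B\<alpha>\<close> and translating \<open>\<psi>\<close> does not change the integral, \<open>\<integral> W(\<psi>, \<eta>) d\<psi>\<close> is the
  derivative of \<open>t \<mapsto> g(\<eta> + t \<beta>\<^sub>d)\<close> at \<open>0\<close>. It vanishes wherever the periodic function \<open>g\<close> has a global
  maximum or minimum; if these coincide modulo \<open>1\<close>, then \<open>g\<close> is constant.
\<close>

section \<open>Power series in several variables are continuously differentiable\<close>

text \<open>Since \<open>n \<le> 2 ^ n\<close>, halving the radius absorbs the factor
  \<open>n\<close> produced by differentiating an \<open>n\<close>-th power.\<close>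

lemma nat_mult_half_power_le:
  fixes \<rho> :: real
  assumes "\<rho> > 0"
  shows "real n * (\<rho> / 2) ^ (n - 1) \<le> 2 / \<rho> * \<rho> ^ n"
proof (cases n)
  case 0
  then show ?thesis using assms by simp
next
  case (Suc m)
  have "real (Suc m) \<le> 2 ^ Suc m"
    using less_exp[of "Suc m"] by (metis of_nat_less_numeral_power_cancel_iff less_imp_le)
  then have "real (Suc m) * \<rho> ^ m \<le> 2 ^ Suc m * \<rho> ^ m"
    using assms by (intro mult_right_mono) auto
  then show ?thesis
    using Suc assms by (simp add: power_divide field_simps)
qed

text \<open>The constant functions form a copy of the naturals. With countability this lets the
  multi-indices be enumerated bijectively.\<close>

lemma infinite_UNIV_nat_fun: "infinite (UNIV :: ('d \<Rightarrow> nat) set)"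
proof -
  have "inj (\<lambda>n::nat. (\<lambda>_::'d. n))"
    by (auto simp: inj_def fun_eq_iff)
  then show ?thesis
    by (rule infinite_super[OF subset_UNIV range_inj_infinite])
qed

definition monomial :: "real ^ 'd::finite \<Rightarrow> ('d \<Rightarrow> nat) \<Rightarrow> real ^ 'd \<Rightarrow> real" where
  "monomial x k y = (\<Prod>i\<in>UNIV. (y $ i - x $ i) ^ k i)"

text \<open>The differential at \<open>y\<close> applied to \<open>h\<close>, as the product rule
  delivers it. The truncated exponent at \<open>k i = 0\<close> is harmless because the factor
  \<open>real (k i)\<close> vanishes there.\<close>

definition monomial_deriv :: "real ^ 'd::finite \<Rightarrow> ('d \<Rightarrow> nat) \<Rightarrow> real ^ 'd \<Rightarrow> real ^ 'd \<Rightarrow> real" where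
  "monomial_deriv x k y h =
     (\<Sum>i\<in>UNIV. h $ i * (real (k i) * (y $ i - x $ i) ^ (k i - 1)) * (\<Prod>j\<in>UNIV - {i}. (y $ j - x $ j) ^ k j))"

lemma has_derivative_monomial:
  "(monomial x k has_derivative monomial_deriv x k y) (at y within S)"
proof -
  have *: "((\<lambda>y. (y $ i - x $ i) ^ k i) has_derivative
      (\<lambda>h. h $ i * (real (k i) * (y $ i - x $ i) ^ (k i - 1)))) (at y within S)" for i
    by (auto intro!: derivative_eq_intros bounded_linear_imp_has_derivative simp: algebra_simps)
  show ?thesis
    unfolding monomial_def[abs_def] monomial_deriv_def[abs_def]
    by (intro has_derivative_prod *)
qed

lemma continuous_on_monomial_deriv:
  "continuous_on S (\<lambda>y. monomial_deriv x k y h)"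
  unfolding monomial_deriv_def by (intro continuous_intros)

text \<open>The product of the \<open>\<rho> ^ k i\<close> is the value of the monomial at the
  corner \<open>x + (\<rho>, ..., \<rho>)\<close>. So absolute convergence at that one point
  controls all differentiated terms nearby.\<close>

lemma monomial_deriv_bound:
  fixes x y h :: "real ^ 'd::finite"
  assumes "\<rho> > 0" and y: "\<And>i. \<bar>y $ i - x $ i\<bar> \<le> \<rho> / 2"
  shows "\<bar>monomial_deriv x k y h\<bar> \<le> real CARD('d) * (2 / \<rho>) * (\<Prod>i\<in>UNIV. \<rho> ^ k i) * norm h"
proof -
  have "\<bar>h $ i * (real (k i) * (y $ i - x $ i) ^ (k i - 1)) * (\<Prod>j\<in>UNIV - {i}. (y $ j - x $ j) ^ k j)\<bar>
     \<le> norm h * (2 / \<rho> * \<rho> ^ k i) * (\<Prod>j\<in>UNIV - {i}. \<rho> ^ k j)" for i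
  proof -
    have "\<bar>real (k i) * (y $ i - x $ i) ^ (k i - 1)\<bar> \<le> real (k i) * (\<rho> / 2) ^ (k i - 1)"
      using y[of i] by (auto simp: power_abs abs_mult intro!: mult_left_mono power_mono)
    also have "\<dots> \<le> 2 / \<rho> * \<rho> ^ k i"
      by (rule nat_mult_half_power_le) fact
    finally have 1: "\<bar>real (k i) * (y $ i - x $ i) ^ (k i - 1)\<bar> \<le> 2 / \<rho> * \<rho> ^ k i" .
    have "\<bar>(y $ j - x $ j) ^ k j\<bar> \<le> \<rho> ^ k j" for j
      using y[of j] assms(1) by (auto simp: power_abs intro!: power_mono)
    then have 2: "\<bar>\<Prod>j\<in>UNIV - {i}. (y $ j - x $ j) ^ k j\<bar> \<le> (\<Prod>j\<in>UNIV - {i}. \<rho> ^ k j)"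
      unfolding abs_prod by (intro prod_mono) auto
    have "0 \<le> 2 / \<rho> * \<rho> ^ k i"
      using assms(1) by simp
    then have "0 \<le> norm h * (2 / \<rho> * \<rho> ^ k i)"
      by (rule mult_nonneg_nonneg[OF norm_ge_zero])
    with \<open>0 \<le> 2 / \<rho> * \<rho> ^ k i\<close> mult_mono[OF mult_mono[OF component_le_norm_cart[of h i] 1] 2] show ?thesis
      unfolding abs_mult by simp
  qed
  moreover have "norm h * (2 / \<rho> * \<rho> ^ k i) * (\<Prod>j\<in>UNIV - {i}. \<rho> ^ k j)
      = (2 / \<rho>) * (\<Prod>i\<in>UNIV. \<rho> ^ k i) * norm h" for i
    using prod.remove[of UNIV i "\<lambda>i. \<rho> ^ k i"] by simp
  ultimately have "\<bar>monomial_deriv x k y h\<bar> \<le> (\<Sum>i\<in>(UNIV::'d set). (2 / \<rho>) * (\<Prod>i\<in>UNIV. \<rho> ^ k i) * norm h)"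
    unfolding monomial_deriv_def real_norm_def[symmetric]
    by (intro sum_norm_le) (simp only: real_norm_def)
  then show ?thesis by simp
qed

text \<open>Absolute convergence at one corner point gives a summable majorant for the
  differentiated series on a smaller ball. Hence termwise differentiation is legitimate and the
  derivative is a uniform limit of continuous functions.\<close>

lemma power_series_C1_ball:
  fixes V :: "real ^ 'd::finite \<Rightarrow> real"
  assumes r: "r > 0"
    and V: "\<And>y. y \<in> ball x r \<Longrightarrow> ((\<lambda>k. c k * monomial x k y) has_sum V y) UNIV"
  obtains \<epsilon> V' where "\<epsilon> > 0"
    and "\<And>y. y \<in> ball x \<epsilon> \<Longrightarrow> (V has_derivative V' y) (at y)"
    and "\<And>h. continuous_on (ball x \<epsilon>) (\<lambda>y. V' y h)"
proof -
  \<comment> \<open>The Euclidean norm is at most the sum of the absolute coordinates, so the corner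
    with all offsets \<open>\<rho>\<close> has distance at most \<open>r / 2\<close> from
    \<open>x\<close>.\<close>
  define \<rho> where "\<rho> = r / (2 * real CARD('d))"
  have \<rho>: "\<rho> > 0" using r by (simp add: \<rho>_def)
  have card: "real CARD('d) \<ge> 1"
    by (simp add: Suc_leI)
  have \<rho>r: "real CARD('d) * \<rho> < r"
    using r card by (simp add: \<rho>_def)
  have \<rho>_le: "\<rho> \<le> real CARD('d) * \<rho>" 
    using card \<rho> by simp
  define z where "z = x + (\<chi> i. \<rho>)"
  have "norm ((\<chi> i. \<rho>) :: real ^ 'd) \<le> real CARD('d) * \<rho>"
    using norm_le_l1_cart[of "(\<chi> i. \<rho>) :: real ^ 'd"] \<rho> by simp
  then have "z \<in> ball x r"
    using \<rho>r by (simp add: z_def dist_norm)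
  from V[OF this] have "(\<lambda>k. c k * monomial x k z) summable_on UNIV"
    by (auto simp: summable_on_def)
  \<comment> \<open>Unordered summability of reals is absolute summability.\<close>
  then have abs: "(\<lambda>k. \<bar>c k * (\<Prod>i\<in>UNIV. \<rho> ^ k i)\<bar>) summable_on UNIV"
    using summable_on_iff_abs_summable_on_real by (force simp: monomial_def z_def)
  \<comment> \<open>Enumerating the multi-indices turns the unordered sum into an ordinary series,
    the form used by \<open>has_derivative_series\<close> and
    \<open>Weierstrass_m_test\<close>.\<close>
  define e where "e = from_nat_into (UNIV :: ('d \<Rightarrow> nat) set)"
  have e: "bij_betw e UNIV UNIV"
    unfolding e_def by (intro bij_betw_from_nat_into countableI_type infinite_UNIV_nat_fun)
  have "((\<lambda>k. \<bar>c k * (\<Prod>i\<in>UNIV. \<rho> ^ k i)\<bar>) \<circ> e) summable_on UNIV"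
    using abs unfolding summable_on_reindex_bij_betw[OF e, symmetric] by (simp add: o_def)
  then have "summable (\<lambda>n. \<bar>c (e n) * (\<Prod>i\<in>UNIV. \<rho> ^ e n i)\<bar>)"
    using summable_on_imp_summable by (fastforce simp: o_def)
  note summable_mult2[OF this, of "real CARD('d) * (2 / \<rho>)"]
  moreover define M where "M n = \<bar>c (e n) * (\<Prod>i\<in>UNIV. \<rho> ^ e n i)\<bar> * (real CARD('d) * (2 / \<rho>))" for n
  ultimately have M: "summable M" by presburger
  define T where "T n y = c (e n) * monomial x (e n) y" for n y
  define T' where "T' n y h = c (e n) * monomial_deriv x (e n) y h" for n y h
  define V' where "V' y h = (\<Sum>n. T' n y h)" for y h
  \<comment> \<open>On this ball every coordinate differs from that of \<open>x\<close> by at most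
    \<open>\<rho> / 2\<close>, as \<open>monomial_deriv_bound\<close> requires.\<close>
  define S where "S = ball x (\<rho> / 2)"
  have T'_le: "norm (T' n y h) \<le> M n * norm h" if "y \<in> S" for n y h
  proof -
    have "\<bar>y $ i - x $ i\<bar> \<le> \<rho> / 2" for i
      using component_le_norm_cart[of "y - x" i] that by (simp add: S_def dist_norm norm_minus_commute)
    from monomial_deriv_bound[OF \<rho> this, of "e n" h] have "\<bar>c (e n)\<bar> * \<bar>monomial_deriv x (e n) y h\<bar>
      \<le> \<bar>c (e n)\<bar> * (real CARD('d) * (2 / \<rho>) * (\<Prod>i\<in>UNIV. \<rho> ^ e n i) * norm h)"
      by (intro mult_left_mono) auto
    moreover have "\<bar>\<Prod>i\<in>UNIV. \<rho> ^ e n i\<bar> = (\<Prod>i\<in>UNIV. \<rho> ^ e n i)"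
      using \<rho> by (intro abs_of_nonneg prod_nonneg) auto
    ultimately show ?thesis
      by (simp add: T'_def M_def abs_mult mult_ac)
  qed
  have V_sums: "(\<lambda>n. T n y) sums V y" if "y \<in> S" for y
  proof -
    have "y \<in> ball x r"
      using that \<rho>r \<rho>_le \<rho> unfolding S_def mem_ball by linarith
    then have "((\<lambda>n. T n y) has_sum V y) UNIV"
      using V has_sum_reindex_bij_betw[OF e, of "\<lambda>k. c k * monomial x k y"] by (simp add: T_def)
    then show ?thesis by (rule has_sum_imp_sums)
  qed
  have T'_summable: "summable (\<lambda>n. T' n y h)" if "y \<in> S" for y h
    by (rule summable_comparison_test'[OF summable_mult2[OF M, of "norm h"]]) (rule T'_le[OF that])
  \<comment> \<open>The differentiated partial sums converge uniformly in operator norm: their error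
    is a tail of \<open>M\<close> times \<open>norm h\<close>.\<close>
  have tail: "\<forall>\<^sub>F n in sequentially. \<forall>y\<in>S. \<forall>h. norm ((\<Sum>i<n. T' i y h) - V' y h) \<le> \<delta> * norm h"
    if \<delta>: "\<delta> > 0" for \<delta>
  proof -
    obtain N where N: "\<And>n. n \<ge> N \<Longrightarrow> norm (\<Sum>i. M (i + n)) < \<delta>"
      using suminf_exist_split[OF \<delta> M] by blast
    have "norm ((\<Sum>i<n. T' i y h) - V' y h) \<le> \<delta> * norm h" if "n \<ge> N" "y \<in> S" for n y h
    proof -
      have "norm ((\<Sum>i<n. T' i y h) - V' y h) = norm (\<Sum>i. T' (i + n) y h)"
        unfolding V'_def suminf_minus_initial_segment[OF T'_summable[OF that(2)]]
        by (rule norm_minus_commute)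
      also have "\<dots> \<le> (\<Sum>i. M (i + n) * norm h)"
        by (intro norm_suminf_le T'_le that summable_mult2 summable_ignore_initial_segment M)
      also have "\<dots> = (\<Sum>i. M (i + n)) * norm h"
        by (intro suminf_mult2[symmetric] summable_ignore_initial_segment M)
      also have "\<dots> \<le> \<delta> * norm h"
        using N[OF that(1)] by (intro mult_right_mono) auto
      finally show ?thesis .
    qed
    then show ?thesis
      unfolding eventually_sequentially by blast
  qed
  have T_deriv: "(T n has_derivative T' n y) (at y within S)" for n y
    unfolding T_def[abs_def] T'_def[abs_def] by (intro has_derivative_mult_right has_derivative_monomial)
  have "x \<in> S" using \<rho> by (simp add: S_def)
  have "\<exists>g. \<forall>y\<in>S. (\<lambda>n. T n y) sums g y \<and> (g has_derivative V' y) (at y within S)"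
    by (rule has_derivative_series[OF _ T_deriv tail \<open>x \<in> S\<close> V_sums[OF \<open>x \<in> S\<close>]])
       (auto simp: S_def)
  then obtain g where g: "\<And>y. y \<in> S \<Longrightarrow> (\<lambda>n. T n y) sums g y"
      "\<And>y. y \<in> S \<Longrightarrow> (g has_derivative V' y) (at y within S)"
    by blast
  \<comment> \<open>The differentiation theorem yields only some sum function \<open>g\<close>;
    uniqueness of sums identifies it with \<open>V\<close>.\<close>
  have gV: "g y = V y" if "y \<in> S" for y
    using g(1) V_sums that sums_unique2 by blast
  have "open S" by (simp add: S_def)
  show thesis
  proof
    show "\<rho> / 2 > 0" using \<rho> by simp
    fix y assume "y \<in> ball x (\<rho> / 2)"
    then have "y \<in> S" by (simp add: S_def)
    then have "(g has_derivative V' y) (at y)"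
      using g(2) at_within_open[OF _ \<open>open S\<close>] by metis
    then show "(V has_derivative V' y) (at y)"
      by (rule has_derivative_transform_within_open[OF _ \<open>open S\<close> \<open>y \<in> S\<close> gV])
  next
    fix h
    have "uniform_limit S (\<lambda>n y. \<Sum>i<n. T' i y h) (\<lambda>y. V' y h) sequentially"
      unfolding V'_def by (rule Weierstrass_m_test[OF T'_le summable_mult2[OF M]])
    then have "continuous_on S (\<lambda>y. V' y h)"
      by (rule uniform_limit_theorem[rotated])
         (auto simp: T'_def intro!: always_eventually continuous_intros continuous_on_monomial_deriv)
    then show "continuous_on (ball x (\<rho> / 2)) (\<lambda>y. V' y h)"
      by (simp add: S_def)
  qed
qed

text \<open>Frechet derivatives are unique, so \<open>frechet_derivative V\<close> agrees near each
  point with the local termwise derivative and inherits its continuity.\<close>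

lemma real_analytic_C1:
  fixes V :: "real ^ 'd::finite \<Rightarrow> real"
  assumes "real_analytic V"
  shows "(V has_derivative frechet_derivative V (at x)) (at x)"
    and "continuous_on UNIV (\<lambda>y. frechet_derivative V (at y) h)"
proof -
  have *: "\<exists>\<epsilon> V'. \<epsilon> > 0 \<and> (\<forall>y\<in>ball x \<epsilon>. (V has_derivative V' y) (at y)) \<and>
      (\<forall>h. continuous_on (ball x \<epsilon>) (\<lambda>y. V' y h))" for x
  proof -
    obtain r c where "r > 0" and c: "\<forall>y\<in>ball x r. ((\<lambda>k. c k * monomial x k y) has_sum V y) UNIV"
      using assms unfolding real_analytic_def monomial_def by blast
    then obtain \<epsilon> V' where "\<epsilon> > 0" "\<And>y. y \<in> ball x \<epsilon> \<Longrightarrow> (V has_derivative V' y) (at y)"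
        "\<And>h. continuous_on (ball x \<epsilon>) (\<lambda>y. V' y h)"
      using power_series_C1_ball[OF _ bspec[OF c]] by blast
    then show ?thesis
      by (intro exI[of _ \<epsilon>] exI[of _ V']) simp
  qed
  show "(V has_derivative frechet_derivative V (at x)) (at x)"
    using *[of x] centre_in_ball frechet_derivative_works differentiable_def by metis
  show "continuous_on UNIV (\<lambda>y. frechet_derivative V (at y) h)"
    unfolding continuous_on_eq_continuous_at[OF open_UNIV]
  proof
    fix x
    obtain \<epsilon> V' where \<epsilon>: "\<epsilon> > 0" "\<And>y. y \<in> ball x \<epsilon> \<Longrightarrow> (V has_derivative V' y) (at y)"
        "continuous_on (ball x \<epsilon>) (\<lambda>y. V' y h)"
      using * by metis
    have "frechet_derivative V (at y) h = V' y h" if "y \<in> ball x \<epsilon>" for y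
      using frechet_derivative_at[OF \<epsilon>(2)[OF that]] by simp
    then have "continuous_on (ball x \<epsilon>) (\<lambda>y. frechet_derivative V (at y) h)"
      using \<epsilon>(3) by (simp cong: continuous_on_cong_simp)
    then show "isCont (\<lambda>y. frechet_derivative V (at y) h) x"
      using \<epsilon>(1) by (simp add: continuous_on_eq_continuous_at)
  qed
qed

text \<open>The chain rule identifies the entries of \<open>grad\<close> with
  \<open>V' (axis i 1)\<close>, and linearity of \<open>V'\<close> reassembles \<open>a\<close> from
  the axes.\<close>

lemma dir_deriv_eq_frechet:
  fixes V :: "real ^ 'd::finite \<Rightarrow> real"
  assumes "(V has_derivative V') (at x)"
  shows "dir_deriv a V x = V' a"
proof -
  interpret bounded_linear V'
    using assms by (rule has_derivative_bounded_linear)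
  have "deriv (\<lambda>t. V (x + t *\<^sub>R axis i 1)) 0 = V' (axis i 1)" for i
  proof (rule DERIV_imp_deriv)
    have "((\<lambda>t. V (x + t *\<^sub>R axis i 1)) has_derivative (\<lambda>t. V' (t *\<^sub>R axis i 1))) (at 0)"
      by (rule has_derivative_compose[where g = V and f = "\<lambda>t. x + t *\<^sub>R axis i 1"])
         (auto intro!: derivative_eq_intros assms)
    then show "DERIV (\<lambda>t. V (x + t *\<^sub>R axis i 1)) 0 :> V' (axis i 1)"
      by (simp add: has_field_derivative_def scaleR mult_commute_abs)
  qed
  then have "dir_deriv a V x = (\<Sum>i\<in>UNIV. a $ i * V' (axis i 1))"
    by (simp add: dir_deriv_def grad_def inner_vec_def)
  also have "\<dots> = V' (\<Sum>i\<in>UNIV. a $ i *\<^sub>R axis i 1)"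
    by (simp add: sum scaleR)
  also have "(\<Sum>i\<in>UNIV. a $ i *\<^sub>R axis i 1) = a"
    using basis_expansion[of a] by (simp add: scalar_mult_eq_scaleR)
  finally show ?thesis .
qed

section \<open>Translation invariance of the torus integral\<close>

lemma periodic_lattice_axis:
  assumes "periodic_lattice f"
  shows "f (x + axis j 1) = f x"
proof -
  have "of_int_vec (axis j 1) = axis j 1"
    by (auto simp: of_int_vec_def vec_eq_iff axis_def)
  then show ?thesis
    using assms unfolding periodic_lattice_def by metis
qed

text \<open>In the smallest box containing both cubes, the slab below the upper cube and the slab above the
  lower cube differ by a lattice vector.\<close>

lemma integral_unit_cube_shift_axis:
  fixes f :: "real ^ 'd::finite \<Rightarrow> real"
  assumes "continuous_on UNIV f" "periodic_lattice f" and s: "s \<ge> 0"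
  shows "integral (cbox (p + s *\<^sub>R axis j 1) (p + 1 + s *\<^sub>R axis j 1)) f = integral (cbox p (p + 1)) f"
proof -
  let ?e = "axis j 1 :: real ^ 'd"
  let ?Q = "cbox p (p + 1 + s *\<^sub>R ?e)"
  let ?L = "cbox p (p + 1 + (s - 1) *\<^sub>R ?e)"
  let ?L' = "cbox (p + ?e) (p + 1 + s *\<^sub>R ?e)"
  have int: "f integrable_on ?Q"
    by (rule integrable_continuous) (rule continuous_on_subset[OF assms(1)], simp)
  have e: "?e \<in> Basis" by (auto simp: Basis_vec_def)
  have mem: "x \<in> cbox a b \<longleftrightarrow> a $ j \<le> x $ j \<and> x $ j \<le> b $ j \<and> (\<forall>i. i \<noteq> j \<longrightarrow> a $ i \<le> x $ i \<and> x $ i \<le> b $ i)"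
    for x a b :: "real ^ 'd"
    unfolding mem_box_cart by metis
  have ax: "?e $ i = (if i = j then 1 else 0)" for i
    by (simp add: axis_def)
  \<comment> \<open>Two ways of cutting \<open>?Q\<close> in two: below and above
    \<open>p $ j + s\<close>, or below and above \<open>p $ j + 1\<close>. Both work for every
    \<open>s \<ge> 0\<close>, even if the unit cubes are disjoint.\<close>
  have sets: "?Q \<inter> {x. x \<bullet> ?e \<le> p $ j + s} = ?L"
       "?Q \<inter> {x. x \<bullet> ?e \<ge> p $ j + s} = cbox (p + s *\<^sub>R ?e) (p + 1 + s *\<^sub>R ?e)"
       "?Q \<inter> {x. x \<bullet> ?e \<le> p $ j + 1} = cbox p (p + 1)"
       "?Q \<inter> {x. x \<bullet> ?e \<ge> p $ j + 1} = ?L'"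
    using s by (auto simp: set_eq_iff mem inner_axis ax)
  have "integral ?L f = integral (cbox (p + ?e - ?e) (p + 1 + s *\<^sub>R ?e - ?e)) (\<lambda>x. f (x + ?e))"
    using assms(2) by (simp add: periodic_lattice_axis algebra_simps)
  also have "\<dots> = integral ?L' f"
    by (rule integral_shift_cbox)
  finally show ?thesis
    using integral_split[OF int e, of "p $ j + s"] integral_split[OF int e, of "p $ j + 1"]
    unfolding sets by linarith
qed

text \<open>Translating the function moves the cube of integration, and the cube can be moved one
  axis at a time.\<close>

lemma torus_integral_translate:
  fixes f :: "real ^ 'd::finite \<Rightarrow> real"
  assumes f: "continuous_on UNIV f" "periodic_lattice f"
  shows "torus_integral (\<lambda>x. f (x + a)) = torus_integral f"
proof -
  define I where "I p = integral (cbox p (p + 1)) f" for p :: "real ^ 'd"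
  have step: "I (p + s *\<^sub>R axis j 1) = I p" for p s j
  proof (cases "s \<ge> 0")
    case True
    then show ?thesis
      using integral_unit_cube_shift_axis[OF f, of s p j] by (simp add: I_def algebra_simps)
  next
    \<comment> \<open>For negative \<open>s\<close>, the original cube is the shift by
      \<open>- s\<close> of the displaced one.\<close>
    case False
    then show ?thesis
      using integral_unit_cube_shift_axis[OF f, of "- s" "p + s *\<^sub>R axis j 1" j] by (simp add: I_def algebra_simps)
  qed
  have "I (\<Sum>j\<in>S. a $ j *\<^sub>R axis j 1) = I 0" if "finite S" for S
    using that by induction (auto simp: step add.commute[of "_ *\<^sub>R _"])
  moreover have "(\<Sum>j\<in>UNIV. a $ j *\<^sub>R axis j 1) = a"
    using basis_expansion[of a] by (simp add: scalar_mult_eq_scaleR)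
  ultimately have "I a = I 0"
    by (metis finite)
  moreover have "integral (cbox 0 1) (\<lambda>x. f (x + a)) = I a"
    using integral_shift_cbox[of a a "a + 1" f] by (simp add: I_def)
  ultimately show ?thesis
    by (simp add: torus_integral_def I_def)
qed

section \<open>Integer matrices of determinant one, and points with a separate last
  coordinate\<close>

lemma of_int_det: "det (map_matrix real_of_int A) = real_of_int (det A)"
  by (simp add: det_def map_matrix_def)

text \<open>By Cramer's rule with denominator \<open>1\<close>, the solution consists of
  determinants of integer matrices. Thus the inverse of \<open>B\<close> preserves the lattice, and
  composing with it preserves periodicity.\<close>

lemma unimodular_preimage_integral:
  fixes B :: "int ^ 'd ^ 'd::finite"
  assumes "det B = 1"
  obtains m where "map_matrix real_of_int B *v of_int_vec m = of_int_vec k"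
proof
  let ?m = "\<chi> j. det (\<chi> i l. if l = j then k $ i else B $ i $ l)"
  let ?A = "map_matrix real_of_int B"
  have "det (\<chi> i l. if l = j then of_int_vec k $ i else ?A $ i $ l) =
      real_of_int (det (\<chi> i l. if l = j then k $ i else B $ i $ l))" for j
    unfolding of_int_det[symmetric]
    by (intro arg_cong[where f = det]) (simp add: vec_eq_iff map_matrix_def of_int_vec_def)
  then have "of_int_vec ?m = (\<chi> j. det (\<chi> i l. if l = j then of_int_vec k $ i else ?A $ i $ l) / det ?A)"
    using assms by (simp add: of_int_vec_def[of "_ :: int ^ 'd"] vec_eq_iff of_int_det)
  then show "?A *v of_int_vec ?m = of_int_vec k"
    using cramer[of ?A] assms by (simp add: of_int_det)
qed

lemma torus_point_add:
  "torus_point \<psi> \<eta> + x = torus_point (\<psi> + (\<chi> j. x $ Some j)) (\<eta> + x $ None)"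
  by (auto simp: torus_point_def vec_eq_iff split: option.split)

lemma continuous_on_torus_point [continuous_intros]:
  assumes "continuous_on S f" "continuous_on S g"
  shows "continuous_on S (\<lambda>x. torus_point (f x) (g x))"
  unfolding torus_point_def
proof (rule continuous_on_vec_lambda)
  fix i :: "'b option"
  show "continuous_on S (\<lambda>x. case i of None \<Rightarrow> g x | Some j \<Rightarrow> f x $ j)"
    by (cases i) (auto intro!: continuous_intros assms)
qed

section \<open>Extrema of periodic functions of one variable\<close>

text \<open>Compactness of a period gives a maximum and a minimum. If they lie at points congruent
  modulo \<open>1\<close>, then \<open>g\<close> is constant and every point is extremal.\<close>

lemma critical_points_periodic:
  fixes g :: "real \<Rightarrow> real"
  assumes cont: "continuous_on UNIV g" and per: "\<And>x k. g (x + of_int k) = g x"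
    and ext: "\<And>x. (\<forall>y. g y \<le> g x) \<or> (\<forall>y. g x \<le> g y) \<Longrightarrow> P x"
  shows "\<exists>x y. x - y \<notin> \<int> \<and> P x \<and> P y"
proof -
  have red: "g y \<in> g ` {0..1}" for y
    using per[of y "- \<lfloor>y\<rfloor>"] by (intro image_eqI[of _ _ "frac y"])
      (auto simp: frac_def frac_ge_0 less_imp_le[OF frac_lt_1, unfolded frac_def])
  have c: "continuous_on {0..1} g" using cont continuous_on_subset by blast
  obtain M where "M \<in> {0..1}" "\<And>y. y \<in> {0..1} \<Longrightarrow> g y \<le> g M"
    using continuous_attains_sup[OF _ _ c] by auto
  then have M: "g y \<le> g M" for y using red[of y] by auto
  obtain m where "m \<in> {0..1}" "\<And>y. y \<in> {0..1} \<Longrightarrow> g m \<le> g y"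
    using continuous_attains_inf[OF _ _ c] by auto
  then have m: "g m \<le> g y" for y using red[of y] by auto
  show ?thesis
  proof (cases "M - m \<in> \<int>")
    case False
    then show ?thesis using M m ext by blast
  next
    case True
    then obtain k where "M = m + of_int k"
      by (auto elim!: Ints_cases simp: algebra_simps)
    then have "g M = g m" by (simp add: per)
    then have "g x \<le> g y" for x y
      using M[of x] m[of y] by simp
    then have "P x" for x
      using ext by blast
    \<comment> \<open>In the constant case any two incongruent points serve; \<open>1/2\<close> and
      \<open>0\<close> are chosen.\<close>
    moreover have "(1/2 :: real) - 0 \<notin> \<int>"
      by (auto elim!: Ints_cases simp: field_simps)
    ultimately show ?thesis by blast
  qed
qed

section \<open>The average over the first coordinates and its critical points\<close>

theorem theorem2:
  fixes V W :: "real ^ 'n::finite option \<Rightarrow> real"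
    and \<alpha> :: "real ^ 'n option" and \<omega> :: real
    and B :: "int ^ 'n option ^ 'n option"
    and \<Omega> :: "real ^ 'n" and L :: "int ^ 'n option"
  assumes "nonresonant \<alpha>"
    and "resonant \<omega> \<alpha>"
    and "det B = 1"
    and "map_matrix real_of_int B *v (\<omega> *\<^sub>R \<alpha>) = torus_point \<Omega> 0 + of_int_vec L"
    and "\<forall>k :: int ^ 'n. k \<noteq> 0 \<longrightarrow> \<Omega> \<bullet> of_int_vec k \<notin> \<int>"
    and "periodic_lattice V"
    and "real_analytic V"
    and "\<forall>\<theta>. W (map_matrix real_of_int B *v \<theta>) = dir_deriv \<alpha> V \<theta>"
  shows "\<exists>\<eta>\<^sub>1 \<eta>\<^sub>2 :: real. \<eta>\<^sub>1 - \<eta>\<^sub>2 \<notin> \<int>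
           \<and> torus_integral (\<lambda>\<psi>. W (torus_point \<psi> \<eta>\<^sub>1)) = 0
           \<and> torus_integral (\<lambda>\<psi>. W (torus_point \<psi> \<eta>\<^sub>2)) = 0"
proof -
  let ?B = "map_matrix real_of_int B"
  have "invertible ?B"
    by (simp add: invertible_det_nz of_int_det \<open>det B = 1\<close>)
  then obtain A where "?B ** A = mat 1" "A ** ?B = mat 1"
    unfolding invertible_def by blast
  then have AB: "A *v (?B *v x) = x" and BA: "?B *v (A *v x) = x" for x
    by (simp_all add: matrix_vector_mul_assoc)
  define D where "D y = frechet_derivative V (at y) \<alpha>" for y
  note V = real_analytic_C1(1)[OF \<open>real_analytic V\<close>]
  have D_cont: "continuous_on UNIV D"
    unfolding D_def by (rule real_analytic_C1(2)) fact
  have V_cont: "continuous_on UNIV V"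
    using V by (intro has_derivative_continuous_on) auto
  have W: "W x = D (A *v x)" for x
    using assms(8) BA dir_deriv_eq_frechet[OF V] unfolding D_def by metis
  have A_cont [continuous_intros]: "continuous_on S (\<lambda>x. A *v f x)" if "continuous_on S f" for S and f :: "'b::topological_space \<Rightarrow> _"
    by (rule bounded_linear.continuous_on[OF matrix_vector_mul_bounded_linear that])
  define U where "U x = V (A *v x)" for x
  have U_cont: "continuous_on UNIV U"
    unfolding U_def by (intro continuous_on_compose2[OF V_cont] continuous_intros) auto
  have U_per: "U (x + of_int_vec k) = U x" for x k
  proof -
    obtain m where "?B *v of_int_vec m = of_int_vec k"
      using unimodular_preimage_integral[OF \<open>det B = 1\<close>] by blast
    then have "A *v of_int_vec k = of_int_vec m"
      by (metis AB)
    then show ?thesis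
      using \<open>periodic_lattice V\<close> by (simp add: U_def matrix_vector_right_distrib periodic_lattice_def)
  qed
  \<comment> \<open>In the coordinates \<open>x = B \<theta>\<close>, moving along
    \<open>\<alpha>\<close> becomes moving along \<open>\<beta>\<close>.\<close>
  define \<beta> where "\<beta> = ?B *v \<alpha>"
  define g where "g \<eta> = torus_integral (\<lambda>\<psi>. U (torus_point \<psi> \<eta>))" for \<eta>
  have g_cont: "continuous_on UNIV g"
    unfolding g_def torus_integral_def
    by (rule integral_continuous_on_param, unfold split_beta)
       (intro continuous_on_compose2[OF U_cont] continuous_intros, auto)
  have g_per: "g (\<eta> + of_int k) = g \<eta>" for \<eta> k
  proof -
    have "torus_point \<psi> (\<eta> + of_int k) = torus_point \<psi> \<eta> + of_int_vec (axis None k)" for \<psi> :: "real ^ 'n"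
      by (auto simp: torus_point_def of_int_vec_def axis_def vec_eq_iff split: option.split)
    then show ?thesis
      by (simp add: g_def U_per)
  qed
  \<comment> \<open>The average does not see a translation of \<open>\<psi>\<close>. So moving only
    the last coordinate by \<open>t * \<beta> $ None\<close> has the effect of moving along all of
    \<open>t *\<^sub>R \<beta>\<close>, that is, along \<open>t *\<^sub>R \<alpha>\<close> in the
    argument of \<open>V\<close>.\<close>
  have g_shift: "g (\<eta> + t * \<beta> $ None) = torus_integral (\<lambda>\<psi>. V (A *v torus_point \<psi> \<eta> + t *\<^sub>R \<alpha>))" for \<eta> t
  proof -
    let ?f = "\<lambda>\<psi>. U (torus_point \<psi> (\<eta> + t * \<beta> $ None))"
    have "continuous_on UNIV ?f"
      by (intro continuous_on_compose2[OF U_cont] continuous_intros) auto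
    moreover have "periodic_lattice ?f"
      unfolding periodic_lattice_def
    proof (intro allI)
      fix \<psi> and k :: "int ^ 'n"
      have "torus_point (\<psi> + of_int_vec k) \<eta>' =
          torus_point \<psi> \<eta>' + of_int_vec (\<chi> i. case i of None \<Rightarrow> 0 | Some j \<Rightarrow> k $ j)" for \<eta>'
        by (auto simp: torus_point_def of_int_vec_def vec_eq_iff split: option.split)
      then show "?f (\<psi> + of_int_vec k) = ?f \<psi>"
        by (simp add: U_per)
    qed
    ultimately have "g (\<eta> + t * \<beta> $ None) = torus_integral (\<lambda>\<psi>. ?f (\<psi> + (\<chi> j. (t *\<^sub>R \<beta>) $ Some j)))"
      unfolding g_def by (rule torus_integral_translate[symmetric])
    also have "\<dots> = torus_integral (\<lambda>\<psi>. U (torus_point \<psi> \<eta> + t *\<^sub>R \<beta>))"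
      by (simp add: torus_point_add)
    also have "\<dots> = torus_integral (\<lambda>\<psi>. V (A *v torus_point \<psi> \<eta> + t *\<^sub>R \<alpha>))"
      by (simp add: U_def \<beta>_def matrix_vector_right_distrib matrix_vector_mult_scaleR AB)
    finally show ?thesis .
  qed
  \<comment> \<open>Differentiation under the integral sign, justified by joint continuity of
    \<open>D\<close> along the translates; at \<open>t = 0\<close> the integrand is
    \<open>W\<close>.\<close>
  have deriv: "DERIV (\<lambda>t. g (\<eta> + t * \<beta> $ None)) 0 :> torus_integral (\<lambda>\<psi>. W (torus_point \<psi> \<eta>))" for \<eta>
  proof -
    let ?p = "\<lambda>t \<psi>. A *v torus_point \<psi> \<eta> + t *\<^sub>R \<alpha>"
    have "((\<lambda>t. integral (cbox 0 1) (\<lambda>\<psi>. V (?p t \<psi>))) has_field_derivative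
        integral (cbox 0 1) (\<lambda>\<psi>. D (?p 0 \<psi>))) (at 0 within UNIV)"
    proof (rule leibniz_rule_field_derivative)
      fix t \<psi>
      interpret bounded_linear "frechet_derivative V (at (?p t \<psi>))"
        using V by (rule has_derivative_bounded_linear)
      have "((\<lambda>t. V (?p t \<psi>)) has_derivative (\<lambda>s. frechet_derivative V (at (?p t \<psi>)) (s *\<^sub>R \<alpha>))) (at t)"
        by (rule has_derivative_compose[OF _ V]) (auto intro!: derivative_eq_intros)
      then show "((\<lambda>t. V (?p t \<psi>)) has_field_derivative D (?p t \<psi>)) (at t within UNIV)"
        by (simp add: has_field_derivative_def D_def scaleR mult_commute_abs)
      show "(\<lambda>\<psi>. V (?p t \<psi>)) integrable_on cbox 0 1"
        by (intro integrable_continuous continuous_on_compose2[OF V_cont] continuous_intros) auto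
    next
      show "continuous_on (UNIV \<times> cbox 0 1) (\<lambda>(t, \<psi>). D (?p t \<psi>))"
        unfolding split_beta by (intro continuous_on_compose2[OF D_cont] continuous_intros) auto
    qed auto
    then show ?thesis
      by (simp add: g_shift W torus_integral_def)
  qed
  \<comment> \<open>A global extremum of \<open>g\<close> at \<open>\<eta>\<close> makes
    \<open>t = 0\<close> extremal for \<open>g (\<eta> + t * \<beta> $ None)\<close>, so its
    derivative there vanishes. The neighbourhood radius \<open>1\<close> is arbitrary.\<close>
  have "torus_integral (\<lambda>\<psi>. W (torus_point \<psi> \<eta>)) = 0"
    if "(\<forall>\<eta>'. g \<eta>' \<le> g \<eta>) \<or> (\<forall>\<eta>'. g \<eta> \<le> g \<eta>')" for \<eta>
    using that
  proof
    assume "\<forall>\<eta>'. g \<eta>' \<le> g \<eta>"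
    then show ?thesis by (intro DERIV_local_max[OF deriv zero_less_one]) auto
  next
    assume "\<forall>\<eta>'. g \<eta> \<le> g \<eta>'"
    then show ?thesis by (intro DERIV_local_min[OF deriv zero_less_one]) auto
  qed
  then show ?thesis
    by (rule critical_points_periodic[OF g_cont g_per,
          where P = "\<lambda>\<eta>. torus_integral (\<lambda>\<psi>. W (torus_point \<psi> \<eta>)) = 0"])
qed

end
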